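(* Let $d\in\mathbb N$ and let $(c_n)_{n\ge1}$ be a sequence of positive real numbers tending to infinity. There exists a sequence $(b_n)_{n\ge1}$ of positive real numbers with $b_n/c_n\to1$ as $n\to\infty$ such that the following holds: for any measurable $f:\mathbb R^d\to\mathbb R$ satisfying $\lambda(\{x\in\mathbb R^d:|f(x)|\geq\varepsilon\})<\infty$ for every $\varepsilon>0$, one has $f(b_nx)\to0$ as $n\to\infty$ for $\lambda$-almost every $x\in\mathbb R^d$.
   Context: $\mathbb N=\{1,2,3,\dots\}$ and $\lambda$ is the $d$-dimensional Lebesgue measure on $\mathbb R^d$; measurable means Lebesgue measurable. *)

theory Defs
  imports "HOL-Analysis.Analysis"
begin

end

theory Submission
  imports Defs
begin

text \<open>
  The key is to let \<open>b\<close> repeat values: however slowly \<open>c\<close> grows, all the \<open>b n\<close> are drawn from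
  one fixed sparse sequence, and only this sequence enters the measure estimate. The squares \<open>1, 4, 9, \<dots>\<close> serve this purpose for two
  reasons. They grow so fast that the series of \<open>1 / (k\<^sup>2) ^ d\<close> converges in every dimension
  \<open>d \<ge> 1\<close>; the sets on which \<open>\<bar>f (k\<^sup>2 x)\<bar> \<ge> \<epsilon>\<close> are scaled copies of a single set of finite
  measure, so their measures are summable, and the Borel-Cantelli lemma gives \<open>f (k\<^sup>2 x) \<rightarrow> 0\<close>
  almost everywhere (\<open>AE_tendsto_zero_dilations\<close>). They also grow so slowly that the ratio of
  consecutive squares tends to \<open>1\<close>, so replacing \<open>c n\<close> by a neighbouring square gives a
  sequence asymptotic to \<open>c\<close> (\<open>tendsto_next_square_ratio\<close>). Passing from the index \<open>k\<close> to the
  index \<open>n\<close> preserves the limit because the squares chosen tend to infinity with \<open>c n\<close>.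
\<close>

lemma emeasure_lebesgue_vimage_scaleR:
  fixes A :: "'a::euclidean_space set"
  assumes "r > 0"
  shows "emeasure lebesgue ((\<lambda>x. r *\<^sub>R x) -` A) = ennreal (inverse r ^ DIM('a)) * emeasure lebesgue A"
proof -
  have "(\<lambda>x. r *\<^sub>R x) -` A = (\<lambda>x. inverse r *\<^sub>R x + 0) ` A"
    using assms by (force simp: image_iff)
  then show ?thesis
    using emeasure_lebesgue_affine[of "inverse r" "0::'a" A] assms by simp
qed

text \<open>
  Borel-Cantelli for each threshold \<open>\<epsilon> = 1 / (m + 1)\<close>: countably many thresholds suffice for
  convergence, so the exceptional null sets can be united.
\<close>

lemma AE_tendsto_zero_dilations:
  fixes f :: "'a::euclidean_space \<Rightarrow> real" and a :: "nat \<Rightarrow> real"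
  assumes f: "f \<in> borel_measurable lebesgue"
    and fin: "\<And>\<epsilon>. \<epsilon> > 0 \<Longrightarrow> emeasure lebesgue {x. \<bar>f x\<bar> \<ge> \<epsilon>} < \<infinity>"
    and pos: "\<And>k. a k > 0"
    and sum: "summable (\<lambda>k. inverse (a k) ^ DIM('a))"
  shows "AE x in lebesgue. (\<lambda>k. f (a k *\<^sub>R x)) \<longlonglongrightarrow> 0"
proof -
  have small: "AE x in lebesgue. \<forall>\<^sub>F k in sequentially. \<bar>f (a k *\<^sub>R x)\<bar> < \<epsilon>"
    if "\<epsilon> > 0" for \<epsilon> :: real
  proof -
    define A where "A = {x. \<bar>f x\<bar> \<ge> \<epsilon>}"
    define B where "B k = (\<lambda>x. a k *\<^sub>R x) -` A" for k
    have A: "A \<in> sets lebesgue"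
      using borel_measurable_abs[OF f] by (auto simp: A_def borel_measurable_iff_ge)
    have A_fin: "emeasure lebesgue A < \<infinity>"
      using fin[OF that] by (simp add: A_def)
    have B: "B k \<in> sets lebesgue" for k
      using measurable_sets[OF lebesgue_measurable_scaling[of "a k"] A] by (simp add: B_def)
    have em: "emeasure lebesgue (B k) = ennreal (inverse (a k) ^ DIM('a)) * emeasure lebesgue A" for k
      unfolding B_def by (rule emeasure_lebesgue_vimage_scaleR[OF pos])
    have B_fin: "emeasure lebesgue (B k) < \<infinity>" for k
      unfolding em using A_fin by (simp add: ennreal_mult_less_top)
    have "measure lebesgue (B k) = inverse (a k) ^ DIM('a) * measure lebesgue A" for k
      using em[of k] pos[of k] by (simp add: measure_def enn2real_mult)
    then have "summable (\<lambda>k. measure lebesgue (B k))"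
      using summable_mult2[OF sum] by simp
    from borel_cantelli_AE1[OF B B_fin this] show ?thesis
      by (simp add: B_def A_def not_le)
  qed
  have "AE x in lebesgue. \<forall>m::nat. \<forall>\<^sub>F k in sequentially. \<bar>f (a k *\<^sub>R x)\<bar> < inverse (real (Suc m))"
    unfolding AE_all_countable by (intro allI small) simp
  then show ?thesis
  proof eventually_elim
    case (elim x)
    show ?case
    proof (rule tendstoI)
      fix e :: real assume "e > 0"
      then obtain m where m: "inverse (real (Suc m)) < e"
        using reals_Archimedean by blast
      show "\<forall>\<^sub>F k in sequentially. dist (f (a k *\<^sub>R x)) 0 < e"
        using elim[rule_format, of m] by eventually_elim (use m in simp)
    qed
  qed
qed

lemma summable_inverse_squares_power:
  assumes "d \<ge> 1"
  shows "summable (\<lambda>k. inverse ((real (Suc k))\<^sup>2) ^ d)"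
proof -
  have "summable (\<lambda>k. inverse (real k ^ (2 * d)))"
    using assms by (intro inverse_power_summable) simp
  then have "summable (\<lambda>k. inverse (real (Suc k) ^ (2 * d)))"
    by (subst summable_Suc_iff)
  then show ?thesis
    by (simp only: power_inverse power_mult)
qed

text \<open>
  For \<open>c > 0\<close> the square root of the next square exceeds \<open>sqrt c\<close> by at most \<open>1\<close>, which is
  negligible compared with \<open>sqrt c\<close>.
\<close>

lemma tendsto_next_square_ratio:
  fixes c :: "'a \<Rightarrow> real"
  assumes "filterlim c at_top F"
  shows "((\<lambda>n. (real (Suc (nat \<lfloor>sqrt (c n)\<rfloor>)))\<^sup>2 / c n) \<longlongrightarrow> 1) F"
proof -
  define s where "s n = real (Suc (nat \<lfloor>sqrt (c n)\<rfloor>))" for n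
  have c_pos: "\<forall>\<^sub>F n in F. c n > 0"
    using assms by (simp add: filterlim_at_top_dense)
  have sqrt_lim: "filterlim (\<lambda>n. sqrt (c n)) at_top F"
    by (rule filterlim_compose[OF sqrt_at_top assms])
  have upper: "((\<lambda>n. 1 + inverse (sqrt (c n))) \<longlongrightarrow> 1) F"
    using tendsto_add[OF tendsto_const tendsto_inverse_0_at_top[OF sqrt_lim], of 1] by simp
  have "((\<lambda>n. s n / sqrt (c n)) \<longlongrightarrow> 1) F"
  proof (rule tendsto_sandwich[OF _ _ tendsto_const upper])
    show "\<forall>\<^sub>F n in F. 1 \<le> s n / sqrt (c n)"
      using c_pos
    proof eventually_elim
      case (elim n)
      then have "sqrt (c n) > 0" "sqrt (c n) \<le> s n"
        unfolding s_def by (simp, linarith)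
      then show ?case by simp
    qed
    show "\<forall>\<^sub>F n in F. s n / sqrt (c n) \<le> 1 + inverse (sqrt (c n))"
      using c_pos
    proof eventually_elim
      case (elim n)
      then have "sqrt (c n) > 0" by simp
      moreover from this have "s n \<le> sqrt (c n) + 1"
        unfolding s_def by linarith
      ultimately show ?case by (simp add: field_simps)
    qed
  qed
  then have "((\<lambda>n. (s n / sqrt (c n))\<^sup>2) \<longlongrightarrow> 1) F"
    using tendsto_power[where n = 2] by fastforce
  moreover have "\<forall>\<^sub>F n in F. (s n / sqrt (c n))\<^sup>2 = (s n)\<^sup>2 / c n"
    using c_pos by eventually_elim (simp add: power_divide)
  ultimately show ?thesis
    unfolding s_def by (rule Lim_transform_eventually)
qed

theorem theorem5:
  fixes c :: "nat \<Rightarrow> real"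
  assumes c_pos: "\<And>n. n \<ge> 1 \<Longrightarrow> c n > 0"
    and c_lim: "filterlim c at_top sequentially"
  shows "\<exists>b :: nat \<Rightarrow> real.
      (\<forall>n\<ge>1. b n > 0) \<and>
      (\<lambda>n. b n / c n) \<longlonglongrightarrow> 1 \<and>
      (\<forall>f :: real ^ 'd \<Rightarrow> real.
         f \<in> borel_measurable lebesgue \<longrightarrow>
         (\<forall>\<epsilon>>0. emeasure lebesgue {x. \<bar>f x\<bar> \<ge> \<epsilon>} < \<infinity>) \<longrightarrow>
         (AE x in lebesgue. (\<lambda>n. f (b n *\<^sub>R x)) \<longlonglongrightarrow> 0))"
proof -
  \<comment> \<open>Starting the squares at \<open>1\<close> keeps every dilation invertible and every \<open>b n\<close> positive.\<close>
  define a :: "nat \<Rightarrow> real" where "a k = (real (Suc k))\<^sup>2" for k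
  define N where "N n = nat \<lfloor>sqrt (c n)\<rfloor>" for n
  have N_lim: "filterlim N sequentially sequentially"
    unfolding N_def
    by (intro filterlim_compose[OF filterlim_nat_sequentially]
        filterlim_compose[OF filterlim_floor_sequentially] filterlim_compose[OF sqrt_at_top c_lim])
  have "AE x in lebesgue. (\<lambda>n. f (a (N n) *\<^sub>R x)) \<longlonglongrightarrow> 0"
    if f: "f \<in> borel_measurable lebesgue"
      and fin: "\<forall>\<epsilon>>0. emeasure lebesgue {x. \<bar>f x\<bar> \<ge> \<epsilon>} < \<infinity>"
    for f :: "real ^ 'd \<Rightarrow> real"
  proof -
    have "AE x in lebesgue. (\<lambda>k. f (a k *\<^sub>R x)) \<longlonglongrightarrow> 0"
    proof (rule AE_tendsto_zero_dilations[OF f])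
      show "summable (\<lambda>k. inverse (a k) ^ DIM(real ^ 'd))"
        unfolding a_def by (rule summable_inverse_squares_power) (rule DIM_ge_Suc0[unfolded One_nat_def[symmetric]])
    qed (use fin in \<open>simp_all add: a_def\<close>)
    then show ?thesis
      by eventually_elim (rule filterlim_compose[OF _ N_lim])
  qed
  moreover have "(\<lambda>n. a (N n) / c n) \<longlonglongrightarrow> 1"
    unfolding a_def N_def by (rule tendsto_next_square_ratio[OF c_lim])
  moreover have "a (N n) > 0" for n
    by (simp add: a_def)
  ultimately show ?thesis
    by (intro exI[of _ "\<lambda>n. a (N n)"]) blast
qed

end
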